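(* Let $\mathbb{k}$ be a field of characteristic zero and $A,B$ commutative unital $\mathbb{k}$-algebras. If $f,g : A \to B$ are a Frobenius $m$-homomorphism and a Frobenius $n$-homomorphism respectively, then $f+g$ is a Frobenius $(m+n)$-homomorphism.
   Context: For a $\mathbb{k}$-linear map $f : A \to B$ and $k \ge 1$, define $\Phi_k(f)(a_1,\dots,a_k) = \sum_{\sigma \in \Sigma_k} \epsilon(\sigma) f_\sigma(a_1,\dots,a_k)$, where $\epsilon(\sigma)$ is the sign, and if $\sigma = \gamma_1\cdots\gamma_q$ is the disjoint cycle decomposition (including cycles of length one) then $f_\sigma = \prod_j f_{\gamma_j}$ with $f_\gamma(a_1,\dots,a_k) = f(a_{r_1}\cdots a_{r_j})$ for $\gamma = (r_1\,\dots\,r_j)$. $f$ is a Frobenius $n$-homomorphism if $\Phi_{n+1}(f)$ vanishes identically and $f(1) = n\cdot 1_B$. *)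

theory Defs
  imports Complex_Main "HOL-Combinatorics.Permutations" "HOL-Combinatorics.Orbits"
begin

text \<open>The sort \<open>{comm_ring, comm_monoid_mult}\<close> is used instead of \<open>comm_ring_1\<close> because the
  latter requires \<open>0 \<noteq> 1\<close> and would exclude the zero algebra.\<close>

locale comm_unital_algebra = vector_space scale
  for scale :: "'k::field \<Rightarrow> 'a::{comm_ring, comm_monoid_mult} \<Rightarrow> 'a" +
  assumes scale_mult_left: "scale c x * y = scale c (x * y)"

text \<open>For a permutation \<open>\<sigma>\<close> of \<open>{1..k}\<close> (the identity elsewhere), the disjoint cycles, including
  those of length one, are represented by their underlying sets, the \<open>\<sigma>\<close>-orbits. As the algebra
  is commutative, the product over a cycle depends only on its underlying set.\<close>

definition perm_cycles :: "nat \<Rightarrow> (nat \<Rightarrow> nat) \<Rightarrow> nat set set" where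
  "perm_cycles k \<sigma> = orbit \<sigma> ` {1..k}"

definition f_cycle :: "('a::comm_monoid_mult \<Rightarrow> 'b) \<Rightarrow> (nat \<Rightarrow> 'a) \<Rightarrow> nat set \<Rightarrow> 'b" where
  "f_cycle f a C = f (\<Prod>r\<in>C. a r)"

definition f_perm ::
  "('a::comm_monoid_mult \<Rightarrow> 'b::comm_monoid_mult) \<Rightarrow> nat \<Rightarrow> (nat \<Rightarrow> nat) \<Rightarrow> (nat \<Rightarrow> 'a) \<Rightarrow> 'b" where
  "f_perm f k \<sigma> a = (\<Prod>C\<in>perm_cycles k \<sigma>. f_cycle f a C)"

text \<open>The arguments \<open>a\<^sub>1, \<dots>, a\<^sub>k\<close> are given by a function on \<open>nat\<close>, of which only the values
  on \<open>{1..k}\<close> matter. The sign acts through the scalar multiplication \<open>sB\<close> of the target.\<close>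

definition Phi ::
  "('k::field \<Rightarrow> 'b \<Rightarrow> 'b) \<Rightarrow> ('a::comm_monoid_mult \<Rightarrow> 'b::{comm_ring, comm_monoid_mult}) \<Rightarrow>
    nat \<Rightarrow> (nat \<Rightarrow> 'a) \<Rightarrow> 'b" where
  "Phi sB f k a = (\<Sum>\<sigma> | \<sigma> permutes {1..k}. sB (of_int (sign \<sigma>)) (f_perm f k \<sigma> a))"

definition frobenius_hom ::
  "('k::field \<Rightarrow> 'a \<Rightarrow> 'a) \<Rightarrow> ('k \<Rightarrow> 'b \<Rightarrow> 'b) \<Rightarrow> nat \<Rightarrow>
    ('a::{comm_ring, comm_monoid_mult} \<Rightarrow> 'b::{comm_ring, comm_monoid_mult}) \<Rightarrow> bool" where
  "frobenius_hom sA sB n f \<longleftrightarrow>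
     Vector_Spaces.linear sA sB f \<and>
     (\<forall>a. Phi sB f (n + 1) a = 0) \<and>
     f 1 = sB (of_nat n) 1"

end

theory Submission
  imports Defs
begin

text \<open>Writing \<open>\<Phi>\<^sub>S(f)\<close> for the alternating sum over the permutations of a finite index set \<open>S\<close>,
  inserting a new index \<open>x\<close> either as a fixed point or behind some \<open>i\<close> in its cycle gives
  \<open>\<Phi>\<^bsub>S\<union>{x}\<^esub>(f)(a) = f(a\<^sub>x) \<Phi>\<^sub>S(f)(a) - (\<Sum>i\<in>S. \<Phi>\<^sub>S(f)(\<dots>, a\<^sub>i a\<^sub>x, \<dots>))\<close>.
  Hence \<open>\<Phi>\<^sub>S(f)\<close> vanishes for all larger index sets once it vanishes for one size, and by induction
  \<open>\<Phi>\<^sub>S(f + g)(a) = (\<Sum>T\<subseteq>S. \<Phi>\<^sub>T(f)(a) \<Phi>\<^bsub>S-T\<^esub>(g)(a))\<close>. If \<open>S\<close> has \<open>m + n + 1\<close> elements, then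
  \<open>T\<close> has more than \<open>m\<close> elements or \<open>S - T\<close> has more than \<open>n\<close>, so every summand is zero.\<close>

section \<open>Cycle products over arbitrary finite index sets, and the insertion of an index into a
  cycle\<close>

definition cycle_prod ::
  "('a::comm_monoid_mult \<Rightarrow> 'b::comm_monoid_mult) \<Rightarrow> ('i \<Rightarrow> 'i) \<Rightarrow> 'i set \<Rightarrow> ('i \<Rightarrow> 'a) \<Rightarrow> 'b" where
  "cycle_prod f \<sigma> S a = (\<Prod>C\<in>orbit \<sigma> ` S. f (\<Prod>r\<in>C. a r))"

text \<open>General index sets replace \<open>{1..k}\<close> because the addition formula splits the
  indices into a subset and its complement, neither of which need be an initial segment.\<close>

definition Phi_on ::
  "('k::field \<Rightarrow> 'b \<Rightarrow> 'b) \<Rightarrow> ('a::comm_monoid_mult \<Rightarrow> 'b::{comm_ring, comm_monoid_mult}) \<Rightarrow>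
    'i set \<Rightarrow> ('i \<Rightarrow> 'a) \<Rightarrow> 'b" where
  "Phi_on sB f S a = (\<Sum>\<sigma> | \<sigma> permutes S. sB (of_int (sign \<sigma>)) (cycle_prod f \<sigma> S a))"

lemma Phi_eq_Phi_on: "Phi sB f k a = Phi_on sB f {1..k} a"
  by (simp add: Phi_def Phi_on_def f_perm_def perm_cycles_def f_cycle_def cycle_prod_def)

text \<open>Orbits of a permutation of \<open>S\<close> stay inside \<open>S\<close>. This locality
  is what later allows the argument to be changed at an index that only one of two factors
  sees.\<close>

lemma Phi_on_cong:
  assumes "\<And>i. i \<in> S \<Longrightarrow> a i = b i"
  shows "Phi_on sB f S a = Phi_on sB f S b"
proof -
  have "cycle_prod f \<sigma> S a = cycle_prod f \<sigma> S b" if "\<sigma> permutes S" for \<sigma>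
    unfolding cycle_prod_def
  proof (rule prod.cong)
    fix C assume "C \<in> orbit \<sigma> ` S"
    then have "C \<subseteq> S" using permutes_orbit_subset[OF that] by blast
    then have "(\<Prod>r\<in>C. a r) = (\<Prod>r\<in>C. b r)"
      by (intro prod.cong) (auto simp: assms)
    then show "f (\<Prod>r\<in>C. a r) = f (\<Prod>r\<in>C. b r)" by simp
  qed simp
  then show ?thesis unfolding Phi_on_def by (intro sum.cong) auto
qed

text \<open>Since \<open>q\<close> fixes \<open>x\<close>, the composite sends \<open>x\<close> to
  \<open>i\<close> and the \<open>q\<close>-predecessor of \<open>i\<close> to \<open>x\<close>: the
  new index is spliced into the cycle just before \<open>i\<close>.\<close>

lemma orbit_transpose_comp:
  assumes "finite S" "x \<notin> S" "i \<in> S" "q permutes S"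
  defines "\<sigma> \<equiv> transpose x i \<circ> q"
  shows "orbit \<sigma> x = insert x (orbit q i)"
proof -
  have qx: "q x = x" using assms(2,4) by (simp add: permutes_not_in)
  have qne: "q z \<noteq> x" if "z \<noteq> x" for z
    using that qx permutes_inj[OF assms(4)] by (metis injD)
  have perm: "permutation q" using assms(1,4) by (auto simp: permutation_permutes)
  then have "permutation \<sigma>" unfolding \<sigma>_def
    by (intro permutation_compose permutation_swap_id)
  then have self: "x \<in> orbit \<sigma> x" by (rule permutation_self_in_orbit)
  have i: "i \<in> orbit \<sigma> x"
    using orbit.base[of \<sigma> x] qx by (simp add: \<sigma>_def)
  have self_q: "i \<in> orbit q i" using perm by (rule permutation_self_in_orbit)
  show ?thesis
  proof
    show "orbit \<sigma> x \<subseteq> insert x (orbit q i)"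
    proof
      fix z assume "z \<in> orbit \<sigma> x"
      then show "z \<in> insert x (orbit q i)"
      proof induction
        case base
        then show ?case using qx self_q by (simp add: \<sigma>_def)
      next
        case (step y)
        then show ?case
          using qx qne[of y] self_q orbit.step[of y q i]
          by (auto simp: \<sigma>_def transpose_def)
      qed
    qed
    \<comment> \<open>\<open>\<sigma>\<close> and \<open>q\<close> differ only at \<open>x\<close>
      and at the predecessor of \<open>i\<close>; there the values of \<open>q\<close> are
      \<open>x\<close> and \<open>i\<close>, both already known to lie in the orbit.\<close>
    have step: "q z \<in> orbit \<sigma> x" if "z \<in> orbit \<sigma> x" for z
      using that orbit.step[OF that] i qx self qne[of z]
      by (cases "z = x"; cases "q z = i") (auto simp: \<sigma>_def transpose_def)
    have "z \<in> orbit \<sigma> x" if "z \<in> orbit q i" for z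
      using that by induction (use i step in auto)
    then show "insert x (orbit q i) \<subseteq> orbit \<sigma> x" using self by auto
  qed
qed

lemma cycle_prod_insert_fixed:
  assumes "finite S" "x \<notin> S" "q permutes S"
  shows "cycle_prod f q (insert x S) a = f (a x) * cycle_prod f q S a"
proof -
  have "orbit q x = {x}"
    using assms(2,3) by (simp add: orbit_eq_singleton_iff permutes_not_in)
  moreover have "{x} \<notin> orbit q ` S"
    using permutes_orbit_subset[OF assms(3)] assms(2) by blast
  ultimately show ?thesis using assms(1) by (simp add: cycle_prod_def)
qed

text \<open>Only the cycle through \<open>i\<close> changes. It gains the factor \<open>a x\<close>,
  and by commutativity this factor can be absorbed into the entry at \<open>i\<close>.\<close>

lemma cycle_prod_insert_cycle:
  assumes "finite S" "x \<notin> S" "i \<in> S" "q permutes S"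
  shows "cycle_prod f (transpose x i \<circ> q) (insert x S) a = cycle_prod f q S (a(i := a i * a x))"
proof -
  define \<sigma> where "\<sigma> = transpose x i \<circ> q"
  define K where "K = orbit q ` (S - orbit q i)"
  have perm: "permutation q" using assms(1,4) by (auto simp: permutation_permutes)
  then have perm_\<sigma>: "permutation \<sigma>" unfolding \<sigma>_def
    by (intro permutation_compose permutation_swap_id)
  have O_sub: "orbit q i \<subseteq> S" using assms(3,4) permutes_orbit_subset by metis
  then have finO: "finite (orbit q i)" using assms(1) finite_subset by blast
  have self: "y \<in> orbit q y" for y using perm by (rule permutation_self_in_orbit)
  have eqO: "orbit q y = orbit q z" if "y \<in> orbit q z" for y z
    using that cyclic_on_orbit'[OF perm] orbit_cyclic_eq3 by metis
  have orb_x: "orbit \<sigma> x = insert x (orbit q i)"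
    unfolding \<sigma>_def using assms by (rule orbit_transpose_comp)
  have in_O: "orbit \<sigma> y = insert x (orbit q i)" if "y \<in> insert x (orbit q i)" for y
    using that orb_x cyclic_on_orbit'[OF perm_\<sigma>] orbit_cyclic_eq3 by metis
  \<comment> \<open>A \<open>q\<close>-orbit containing neither \<open>x\<close> nor
    \<open>i\<close> avoids both points moved by the transposition, so \<open>\<sigma>\<close> and
    \<open>q\<close> agree along it.\<close>
  have out_O: "orbit \<sigma> y = orbit q y" if "y \<in> S - orbit q i" for y
  proof (rule orbit_cong[OF self])
    fix s assume s: "s \<in> orbit q y"
    have "q s \<in> orbit q y" using s by (rule orbit.step)
    moreover have "i \<notin> orbit q y" using that eqO[of i y] self[of y] by auto
    moreover have "x \<notin> orbit q y"
      using that permutes_orbit_subset[OF assms(4), of y] assms(2) by auto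
    ultimately show "\<sigma> s = q s" by (auto simp: \<sigma>_def transpose_def)
  qed
  have "insert x S = insert x (orbit q i) \<union> (S - orbit q i)" using O_sub by auto
  then have "orbit \<sigma> ` insert x S = orbit \<sigma> ` insert x (orbit q i) \<union> orbit \<sigma> ` (S - orbit q i)"
    by (metis image_Un)
  also have "orbit \<sigma> ` insert x (orbit q i) = {insert x (orbit q i)}"
    using in_O by (auto simp: image_iff)
  also have "orbit \<sigma> ` (S - orbit q i) = K"
    unfolding K_def using out_O by (intro image_cong) auto
  finally have cyc_\<sigma>: "orbit \<sigma> ` insert x S = insert (insert x (orbit q i)) K" by simp
  have "S = orbit q i \<union> (S - orbit q i)" using O_sub by auto
  then have "orbit q ` S = orbit q ` orbit q i \<union> K" unfolding K_def by (metis image_Un)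
  also have "orbit q ` orbit q i = {orbit q i}"
  proof -
    have "orbit q ` orbit q i = (\<lambda>_. orbit q i) ` orbit q i"
      by (intro image_cong refl) (rule eqO)
    then show ?thesis using self[of i] by (simp only: image_constant)
  qed
  finally have cyc_q: "orbit q ` S = insert (orbit q i) K" by simp
  have K_out: "C \<subseteq> S - orbit q i" if "C \<in> K" for C
  proof
    fix z assume "z \<in> C"
    obtain y where y: "y \<in> S - orbit q i" "C = orbit q y" using \<open>C \<in> K\<close> K_def by auto
    have "z \<in> S" using y \<open>z \<in> C\<close> permutes_orbit_subset[OF assms(4), of y] by auto
    moreover have "z \<notin> orbit q i"
      using y \<open>z \<in> C\<close> eqO[of z i] eqO[of z y] self[of y] by auto
    ultimately show "z \<in> S - orbit q i" by simp
  qed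
  have "finite K" using assms(1) by (simp add: K_def)
  \<comment> \<open>Cycles are collected in a set, so a factor splits off the product only if its
    cycle is not already among the others.\<close>
  moreover have "insert x (orbit q i) \<notin> K" "orbit q i \<notin> K"
    using K_out assms(2) self[of i] by blast+
  moreover have "(\<Prod>r\<in>insert x (orbit q i). a r) = (\<Prod>r\<in>orbit q i. (a(i := a i * a x)) r)"
  proof -
    have "x \<notin> orbit q i" using O_sub assms(2) by auto
    then have "(\<Prod>r\<in>insert x (orbit q i). a r) = a x * (a i * (\<Prod>r\<in>orbit q i - {i}. a r))"
      using finO self[of i] by (simp add: prod.remove[of "orbit q i" i])
    also have "\<dots> = (a i * a x) * (\<Prod>r\<in>orbit q i - {i}. (a(i := a i * a x)) r)"
      by (simp add: ac_simps)
    also have "\<dots> = (\<Prod>r\<in>orbit q i. (a(i := a i * a x)) r)"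
      using finO self[of i] by (subst (2) prod.remove[of _ i]) auto
    finally show ?thesis .
  qed
  moreover have "(\<Prod>C\<in>K. f (\<Prod>r\<in>C. a r)) = (\<Prod>C\<in>K. f (\<Prod>r\<in>C. (a(i := a i * a x)) r))"
  proof (rule prod.cong)
    fix C assume "C \<in> K"
    then have "i \<notin> C" using K_out self[of i] by auto
    then have "(\<Prod>r\<in>C. a r) = (\<Prod>r\<in>C. (a(i := a i * a x)) r)" by (intro prod.cong) auto
    then show "f (\<Prod>r\<in>C. a r) = f (\<Prod>r\<in>C. (a(i := a i * a x)) r)" by simp
  qed simp
  ultimately show ?thesis
    unfolding cycle_prod_def \<sigma>_def[symmetric] cyc_\<sigma> cyc_q
    by (simp del: fun_upd_apply)
qed

section \<open>The recursion for \<open>Phi_on\<close>, its vanishing on larger sets, and the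
  addition formula\<close>

context comm_unital_algebra
begin

lemma Phi_on_empty: "Phi_on scale f {} a = 1"
  by (simp add: Phi_on_def cycle_prod_def)

text \<open>Each permutation of \<open>insert x S\<close> is uniquely
  \<open>transpose x i \<circ> q\<close> with \<open>i\<close> in \<open>insert x S\<close> and
  \<open>q\<close> a permutation of \<open>S\<close>. The case \<open>i = x\<close> adds a fixed
  point; every other \<open>i\<close> flips the sign.\<close>

lemma Phi_on_insert:
  assumes "finite S" "x \<notin> S"
  shows "Phi_on scale f (insert x S) a =
    f (a x) * Phi_on scale f S a - (\<Sum>i\<in>S. Phi_on scale f S (a(i := a i * a x)))"
proof -
  let ?t = "\<lambda>\<sigma>. scale (of_int (sign \<sigma>)) (cycle_prod f \<sigma> (insert x S) a)"
  \<comment> \<open>The trivial transposition is kept so that this matches the summand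
    \<open>i = x\<close> of \<open>sum_over_permutations_insert\<close>.\<close>
  have fixed: "?t (transpose x x \<circ> q) = f (a x) * scale (of_int (sign q)) (cycle_prod f q S a)"
    if "q permutes S" for q
    using cycle_prod_insert_fixed[OF assms that, of f a]
    by (simp add: mult.commute[of "f (a x)"] scale_mult_left)
  have cycle: "?t (transpose x i \<circ> q) =
      - scale (of_int (sign q)) (cycle_prod f q S (a(i := a i * a x)))"
    if "q permutes S" "i \<in> S" for q i
  proof -
    have "permutation q" using assms(1) that(1) by (auto simp: permutation_permutes)
    moreover have "x \<noteq> i" using assms(2) that(2) by auto
    ultimately have "sign (transpose x i \<circ> q) = - sign q"
      by (simp add: sign_compose permutation_swap_id sign_swap_id)
    then show ?thesis using cycle_prod_insert_cycle[OF assms that(2,1), of f a] by simp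
  qed
  have "Phi_on scale f (insert x S) a =
      (\<Sum>q | q permutes S. ?t (transpose x x \<circ> q)) +
      (\<Sum>i\<in>S. \<Sum>q | q permutes S. ?t (transpose x i \<circ> q))"
    unfolding Phi_on_def sum_over_permutations_insert[OF assms] using assms by simp
  also have "(\<Sum>q | q permutes S. ?t (transpose x x \<circ> q)) = f (a x) * Phi_on scale f S a"
    unfolding Phi_on_def sum_distrib_left by (intro sum.cong) (use fixed in auto)
  also have "(\<Sum>i\<in>S. \<Sum>q | q permutes S. ?t (transpose x i \<circ> q)) =
      (\<Sum>i\<in>S. - Phi_on scale f S (a(i := a i * a x)))"
    unfolding Phi_on_def sum_negf[symmetric] by (intro sum.cong) (use cycle in auto)
  finally show ?thesis by (simp add: sum_negf)
qed

text \<open>Invariance under relabelling follows from the recursion by induction, without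
  conjugating permutations or comparing their signs.\<close>

lemma Phi_on_image:
  assumes "finite S" "inj_on h S"
  shows "Phi_on scale f (h ` S) a = Phi_on scale f S (a \<circ> h)"
  using assms
proof (induction S arbitrary: a rule: finite_induct)
  case empty
  then show ?case by (simp add: Phi_on_empty)
next
  case (insert x S)
  have inj: "inj_on h S" and hx: "h x \<notin> h ` S" using insert.prems insert.hyps by auto
  have "Phi_on scale f (h ` S) (a(h i := a (h i) * a (h x))) =
      Phi_on scale f S ((a \<circ> h)(i := (a \<circ> h) i * (a \<circ> h) x))" (is "?L i = ?R i") if "i \<in> S" for i
  proof -
    have "Phi_on scale f (h ` S) (a(h i := a (h i) * a (h x))) =
        Phi_on scale f S (a(h i := a (h i) * a (h x)) \<circ> h)"
      using insert.IH[OF inj] .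
    also have "\<dots> = Phi_on scale f S ((a \<circ> h)(i := (a \<circ> h) i * (a \<circ> h) x))"
      \<comment> \<open>By injectivity, the update at \<open>h i\<close> is seen through
        \<open>h\<close> at no index of \<open>S\<close> other than \<open>i\<close>.\<close>
      by (rule Phi_on_cong) (use inj that in \<open>auto dest: inj_onD\<close>)
    finally show ?thesis .
  qed
  then have "(\<Sum>i\<in>S. ?L i) = (\<Sum>i\<in>S. ?R i)" by (rule sum.cong[OF refl])
  moreover have "Phi_on scale f (h ` insert x S) a =
      f (a (h x)) * Phi_on scale f (h ` S) a - (\<Sum>i\<in>S. ?L i)"
    using insert.hyps(1) hx inj
    by (simp add: Phi_on_insert sum.reindex comp_def del: fun_upd_apply)
  ultimately show ?case
    by (simp only: Phi_on_insert insert.hyps insert.IH[OF inj] comp_apply not_False_eq_True)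
qed

text \<open>Induction on the excess of \<open>card S\<close> over \<open>k\<close>: every term of
  the recursion contains a value of \<open>Phi_on\<close> on a set with one element fewer. The
  merged arguments require vanishing for all \<open>a\<close>.\<close>

lemma Phi_on_eq_0:
  assumes "\<And>a. Phi scale f k a = 0" and "finite S" "card S \<ge> k"
  shows "Phi_on scale f S a = 0"
proof -
  have "finite S \<Longrightarrow> card S = k + n \<Longrightarrow> Phi_on scale f S a = 0" for n
  proof (induction n arbitrary: S a)
    case 0
    then obtain h where "bij_betw h {1..k} S"
      using finite_same_card_bij[of "{1..k}" S] by auto
    then have "inj_on h {1..k}" "S = h ` {1..k}" by (auto simp: bij_betw_def)
    then show ?case
      using assms(1) Phi_on_image[OF finite_atLeastAtMost] by (metis Phi_eq_Phi_on)
  next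
    case (Suc n)
    then obtain x T where T: "S = insert x T" "x \<notin> T" "card T = k + n"
      by (auto simp: card_Suc_eq)
    with Suc.prems have "finite T" by simp
    then show ?case using T Suc.IH[OF \<open>finite T\<close>] by (simp add: Phi_on_insert)
  qed
  from this[of "card S - k"] show ?thesis using assms(2,3) by simp
qed

text \<open>The merging terms of the recursion obey a Leibniz rule: each \<open>i\<close> lies in
  exactly one of \<open>T\<close> and \<open>S - T\<close>, so merging \<open>a x\<close> into
  \<open>a i\<close> affects a single factor. The terms then regroup into the recursions for
  \<open>insert x T\<close> and \<open>insert x (S - T)\<close>.\<close>

lemma Phi_on_add:
  assumes "finite S"
  shows "Phi_on scale (\<lambda>x. f x + g x) S a =
    (\<Sum>T\<in>Pow S. Phi_on scale f T a * Phi_on scale g (S - T) a)"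
  using assms
proof (induction S arbitrary: a rule: finite_induct)
  case empty
  then show ?case by (simp add: Phi_on_empty)
next
  case (insert x S)
  let ?F = "Phi_on scale f" and ?G = "Phi_on scale g"
  let ?a = "\<lambda>i. a(i := a i * a x)"
  have step: "(f (a x) + g (a x)) * (?F T a * ?G (S - T) a) -
      (\<Sum>i\<in>S. ?F T (?a i) * ?G (S - T) (?a i)) =
      ?F (insert x T) a * ?G (S - T) a + ?F T a * ?G (insert x (S - T)) a"
    if "T \<subseteq> S" for T
  proof -
    have fin: "finite T" "finite (S - T)" using that insert.hyps(1) finite_subset by auto
    have x: "x \<notin> T" "x \<notin> S - T" using that insert.hyps(2) by auto
    have "(\<Sum>i\<in>S. ?F T (?a i) * ?G (S - T) (?a i)) =
        (\<Sum>i\<in>S - T. ?F T (?a i) * ?G (S - T) (?a i)) + (\<Sum>i\<in>T. ?F T (?a i) * ?G (S - T) (?a i))"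
      using that insert.hyps(1) by (rule sum.subset_diff)
    \<comment> \<open>For \<open>i\<close> in \<open>T\<close> the update at \<open>i\<close> is
      invisible to the factor on \<open>S - T\<close>, which therefore leaves the sum; the next step
      is symmetric.\<close>
    also have "(\<Sum>i\<in>T. ?F T (?a i) * ?G (S - T) (?a i)) = (\<Sum>i\<in>T. ?F T (?a i)) * ?G (S - T) a"
      unfolding sum_distrib_right
      by (intro sum.cong refl arg_cong2[where f = "(*)"] Phi_on_cong) auto
    also have "(\<Sum>i\<in>S - T. ?F T (?a i) * ?G (S - T) (?a i)) = ?F T a * (\<Sum>i\<in>S - T. ?G (S - T) (?a i))"
      unfolding sum_distrib_left
      by (intro sum.cong refl arg_cong2[where f = "(*)"] Phi_on_cong) auto
    finally show ?thesis
      unfolding Phi_on_insert[OF fin(1) x(1)] Phi_on_insert[OF fin(2) x(2)]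
      by (simp add: algebra_simps del: fun_upd_apply)
  qed
  \<comment> \<open>The induction hypothesis is applied to \<open>a\<close> and to every merged
    argument \<open>?a i\<close>; the sums over \<open>i\<close> and \<open>T\<close> are then
    interchanged.\<close>
  have "Phi_on scale (\<lambda>x. f x + g x) (insert x S) a =
      (\<Sum>T\<in>Pow S. (f (a x) + g (a x)) * (?F T a * ?G (S - T) a)) -
      (\<Sum>T\<in>Pow S. \<Sum>i\<in>S. ?F T (?a i) * ?G (S - T) (?a i))"
    using insert by (simp add: Phi_on_insert sum_distrib_left sum.swap[of _ S] del: fun_upd_apply)
  also have "\<dots> = (\<Sum>T\<in>Pow S. ?F (insert x T) a * ?G (S - T) a + ?F T a * ?G (insert x (S - T)) a)"
    unfolding sum_subtractf[symmetric] by (intro sum.cong refl step) auto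
  \<comment> \<open>The two summands account for the subsets of \<open>insert x S\<close> that
    contain \<open>x\<close> and those that avoid it.\<close>
  also have "\<dots> = (\<Sum>T\<in>Pow (insert x S). ?F T a * ?G (insert x S - T) a)"
  proof -
    have "(\<Sum>T\<in>insert x ` Pow S. ?F T a * ?G (insert x S - T) a) =
        (\<Sum>T\<in>Pow S. ?F (insert x T) a * ?G (S - T) a)"
    proof (rule sum.reindex_cong[of "insert x"])
      show "inj_on (insert x) (Pow S)"
        using insert.hyps(2) by (auto simp: inj_on_def)
    qed (use insert.hyps(2) in auto)
    moreover have "(\<Sum>T\<in>Pow S. ?F T a * ?G (insert x S - T) a) =
        (\<Sum>T\<in>Pow S. ?F T a * ?G (insert x (S - T)) a)"
      by (intro sum.cong refl arg_cong2[where f = "(*)"] arg_cong2[where f = "?G"])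
        (use insert.hyps(2) in auto)
    moreover have "Pow S \<inter> insert x ` Pow S = {}" using insert.hyps(2) by auto
    ultimately show ?thesis
      using insert.hyps(1) by (simp add: Pow_insert sum.union_disjoint sum.distrib add.commute)
  qed
  finally show ?case .
qed

end

theorem theorem2p9:
  fixes sA :: "'k::field_char_0 \<Rightarrow> 'a::{comm_ring, comm_monoid_mult} \<Rightarrow> 'a"
    and sB :: "'k \<Rightarrow> 'b::{comm_ring, comm_monoid_mult} \<Rightarrow> 'b"
    and f g :: "'a \<Rightarrow> 'b"
    and m n :: nat
  assumes "comm_unital_algebra sA"
    and "comm_unital_algebra sB"
    and "frobenius_hom sA sB m f"
    and "frobenius_hom sA sB n g"
  shows "frobenius_hom sA sB (m + n) (\<lambda>x. f x + g x)"
proof -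
  interpret A: comm_unital_algebra sA by fact
  interpret B: comm_unital_algebra sB by fact
  interpret vector_space_pair sA sB ..
  have f: "Vector_Spaces.linear sA sB f" "Phi sB f (m + 1) a = 0" "f 1 = sB (of_nat m) 1"
    and g: "Vector_Spaces.linear sA sB g" "Phi sB g (n + 1) a = 0" "g 1 = sB (of_nat n) 1" for a
    using assms(3,4) by (auto simp: frobenius_hom_def)
  have "Phi sB (\<lambda>x. f x + g x) (m + n + 1) a = 0" for a
    unfolding Phi_eq_Phi_on B.Phi_on_add[OF finite_atLeastAtMost]
  proof (intro sum.neutral ballI)
    fix T :: "nat set" assume "T \<in> Pow {1..m + n + 1}"
    then have T: "T \<subseteq> {1..m + n + 1}" by simp
    then have fin: "finite T" "finite ({1..m + n + 1} - T)" using finite_subset by auto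
    have "card ({1..m + n + 1} - T) = m + n + 1 - card T"
      using T fin by (simp add: card_Diff_subset)
    then consider "card T \<ge> m + 1" | "card ({1..m + n + 1} - T) \<ge> n + 1" by linarith
    then show "Phi_on sB f T a * Phi_on sB g ({1..m + n + 1} - T) a = 0"
    proof cases
      case 1
      then show ?thesis using B.Phi_on_eq_0[OF f(2) fin(1)] by simp
    next
      case 2
      then show ?thesis using B.Phi_on_eq_0[OF g(2) fin(2)] by simp
    qed
  qed
  moreover have "Vector_Spaces.linear sA sB (\<lambda>x. f x + g x)"
    using f(1) g(1) by (rule linear_compose_add)
  moreover have "f 1 + g 1 = sB (of_nat (m + n)) 1"
    using f(3) g(3) by (simp add: B.scale_left_distrib)
  ultimately show ?thesis by (simp add: frobenius_hom_def)
qed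

end
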